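(* Let $K$ be an arbitrary imaginary quadratic field. Suppose $P\in{\rm Mat}(h,h;\mathbb{Q})$ is a positive-definite symmetric matrix and let $A_0,B_0\in{\rm Mat}(g,h;K)$. Then there exist positive rational numbers $\lambda_1,\ldots,\lambda_h$ such that $\Theta^P\begin{bmatrix} A_0 \\ B_0 \end{bmatrix}(W)$ (associated with $K$) is expressed by a homogeneous polynomial of degree $h$ over $\mathbb{Q}$ in the functions $\Theta\begin{bmatrix} a \\ b \end{bmatrix}(\lambda_j W)$ ($j\in\{1,\ldots,h\}$, $a,b\in K^g$).
   Context: $K=\mathbb{Q}(\sqrt{-d})$, $\mathfrak{O}_K$ its ring of integers, $\mathbb{H}_I^{(g)}=\{W\in{\rm Mat}(g,g;\mathbb{C}) \mid \frac{W-{}^t\overline{W}}{2\sqrt{-1}} \text{ positive-definite Hermitian}\}$. For positive-definite Hermitian $P$ of size $h$ and $A_0,B_0\in{\rm Mat}(g,h;K)$, $\Theta^P\begin{bmatrix} A_0 \\ B_0 \end{bmatrix}(W)=\sum_{N\in{\rm Mat}(g,h;\mathfrak{O}_K)}\exp\left(\pi\sqrt{-1}\,{\rm Tr}\left({}^t\overline{(N+A_0)}W(N+A_0)P\right)+2\pi\sqrt{-1}\,{\rm Re}\,{\rm Tr}\left({}^t\overline{(N+A_0)}B_0\right)\right)$, and for $a,b\in K^g$, $\Theta\begin{bmatrix} a \\ b \end{bmatrix}(W)=\sum_{n\in\mathfrak{O}_K^g}\exp\left(\pi\sqrt{-1}\,{}^t\overline{(n+a)}W(n+a)+2\pi\sqrt{-1}\,{\rm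 Re}\left({}^t\overline{(n+a)}b\right)\right)$. *)

theory Defs
  imports
    "HOL-Analysis.Analysis"
    "HOL-Computational_Algebra.Computational_Algebra"
    "HOL-Library.Poly_Mapping"
begin

text \<open>Number fields are subsets of the complex numbers, since complex conjugation enters the
  theta series.\<close>

definition quad_field :: "nat \<Rightarrow> complex set" where
  "quad_field d = {of_rat x + of_rat y * (\<i> * complex_of_real (sqrt (real d))) | x y. True}"

definition imaginary_quadratic_field :: "complex set \<Rightarrow> bool" where
  "imaginary_quadratic_field K \<longleftrightarrow> (\<exists>d::nat. d > 0 \<and> squarefree d \<and> K = quad_field d)"

definition ring_of_integers :: "complex set \<Rightarrow> complex set" where
  "ring_of_integers K = {x \<in> K. algebraic_int x}"

definition vec_over :: "'a set \<Rightarrow> ('a ^ 'n) set" where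
  "vec_over S = {v. \<forall>i. v $ i \<in> S}"

definition mat_over :: "'a set \<Rightarrow> ('a ^ 'n ^ 'm) set" where
  "mat_over S = {A. \<forall>i j. A $ i $ j \<in> S}"

definition conj_transpose :: "complex ^ 'n ^ 'm \<Rightarrow> complex ^ 'm ^ 'n" where
  "conj_transpose A = (\<chi> i j. cnj (A $ j $ i))"

definition sesq :: "complex ^ 'n \<Rightarrow> complex ^ 'n \<Rightarrow> complex" where
  "sesq x y = (\<Sum>i\<in>UNIV. cnj (x $ i) * y $ i)"

text \<open>For Hermitian \<open>A\<close> the value \<open>sesq x (A *v x)\<close> is real, so taking the real part loses
  nothing.\<close>

definition hermitian_pos_def :: "complex ^ 'n ^ 'n \<Rightarrow> bool" where
  "hermitian_pos_def A \<longleftrightarrow>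
     conj_transpose A = A \<and> (\<forall>x. x \<noteq> 0 \<longrightarrow> Re (sesq x (A *v x)) > 0)"

definition symmetric_pos_def :: "real ^ 'n ^ 'n \<Rightarrow> bool" where
  "symmetric_pos_def A \<longleftrightarrow> transpose A = A \<and> (\<forall>x. x \<noteq> 0 \<longrightarrow> x \<bullet> (A *v x) > 0)"

definition complex_mat :: "real ^ 'n ^ 'm \<Rightarrow> complex ^ 'n ^ 'm" where
  "complex_mat A = (\<chi> i j. complex_of_real (A $ i $ j))"

definition hermitian_upper_half_space :: "(complex ^ 'g ^ 'g) set" where
  "hermitian_upper_half_space =
     {W. hermitian_pos_def (\<chi> i j. (W - conj_transpose W) $ i $ j / (2 * \<i>))}"

definition Theta_mat ::
  "complex set \<Rightarrow> complex ^ 'h ^ 'h \<Rightarrow> complex ^ 'h ^ 'g \<Rightarrow> complex ^ 'h ^ 'g \<Rightarrow>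
   complex ^ 'g ^ 'g \<Rightarrow> complex" where
  "Theta_mat K P A B W =
     (\<Sum>\<^sub>\<infinity>N\<in>mat_over (ring_of_integers K).
        exp (complex_of_real pi * \<i> * trace (conj_transpose (N + A) ** W ** (N + A) ** P)
             + 2 * complex_of_real pi * \<i>
               * complex_of_real (Re (trace (conj_transpose (N + A) ** B)))))"

definition Theta_vec ::
  "complex set \<Rightarrow> complex ^ 'g \<Rightarrow> complex ^ 'g \<Rightarrow> complex ^ 'g ^ 'g \<Rightarrow> complex" where
  "Theta_vec K a b W =
     (\<Sum>\<^sub>\<infinity>n\<in>vec_over (ring_of_integers K).
        exp (complex_of_real pi * \<i> * sesq (n + a) (W *v (n + a))
             + 2 * complex_of_real pi * \<i> * complex_of_real (Re (sesq (n + a) b))))"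

text \<open>A polynomial over the rationals in a possibly infinite set of indeterminates \<open>'v\<close> is a
  finitely supported map from monomials to coefficients, a monomial being a finitely supported map
  from indeterminates to exponents. As usual, the zero polynomial is homogeneous of every
  degree.\<close>

type_synonym 'v rat_mpoly = "('v \<Rightarrow>\<^sub>0 nat) \<Rightarrow>\<^sub>0 rat"

definition mpoly_vars :: "'v rat_mpoly \<Rightarrow> 'v set" where
  "mpoly_vars p = (\<Union>m\<in>Poly_Mapping.keys p. Poly_Mapping.keys m)"

definition mpoly_homogeneous :: "nat \<Rightarrow> 'v rat_mpoly \<Rightarrow> bool" where
  "mpoly_homogeneous n p \<longleftrightarrow>
     (\<forall>m\<in>Poly_Mapping.keys p. (\<Sum>v\<in>Poly_Mapping.keys m. Poly_Mapping.lookup m v) = n)"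

definition mpoly_eval :: "'v rat_mpoly \<Rightarrow> ('v \<Rightarrow> complex) \<Rightarrow> complex" where
  "mpoly_eval p f =
     (\<Sum>m\<in>Poly_Mapping.keys p. of_rat (Poly_Mapping.lookup p m) *
        (\<Prod>v\<in>Poly_Mapping.keys m. f v ^ Poly_Mapping.lookup m v))"

end

theory Submission
  imports Defs
begin

text \<open>Gram-Schmidt over the rationals yields an invertible integral matrix \<open>S\<close> such that
  \<open>S P S\<^sup>t\<close> is diagonal with positive rational entries \<open>lam j\<close>. Let \<open>L\<close> be the lattice of integral
  \<open>g \<times> h\<close> matrices. The sublattice \<open>L S\<close> has finite index in \<open>L\<close>, and on a coset \<open>r + L S\<close> one has
  \<open>N + A = Y S\<close> with \<open>Y\<close> in \<open>L + (r + A) S\<^sup>-\<^sup>1\<close>; the exponent then splits into a sum over the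
  columns of \<open>Y\<close>. Hence each coset contributes a product of \<open>h\<close> vector theta series, and the
  polynomial is the sum of these monomials over the finitely many cosets. That integers of the
  quadratic field form a lattice is read off from the description by trace and norm:
  \<open>z\<close> is integral iff \<open>2 Re z\<close> and \<open>\<bar>z\<bar>\<^sup>2\<close> are integers.\<close>

section \<open>Integers of imaginary quadratic fields\<close>

lemma map_poly_of_int_add:
  "map_poly of_int (p + q) = (map_poly of_int p + map_poly of_int q :: 'a :: comm_ring_1 poly)"
  by (intro poly_eqI) (simp add: coeff_map_poly)

lemma map_poly_of_int_mult:
  "map_poly of_int (p * q) = (map_poly of_int p * map_poly of_int q :: 'a :: comm_ring_1 poly)"
  by (intro poly_eqI) (simp add: coeff_map_poly coeff_mult)

lemma map_poly_of_int_smult: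
  "map_poly of_int (smult c p) = (smult (of_int c) (map_poly of_int p) :: 'a :: comm_ring_1 poly)"
  by (intro poly_eqI) (simp add: coeff_map_poly)

lemma complex_of_rat_eq: "(of_rat x :: complex) = of_real (of_rat x)"
  by (cases x) (simp add: of_rat_rat)

lemma square_eq_trace_norm:
  fixes z :: complex
  shows "z\<^sup>2 = of_real (2 * Re z) * z - of_real ((cmod z)\<^sup>2)"
  unfolding cmod_power2 by (simp add: complex_eq_iff power2_eq_square algebra_simps)

lemma real_linear_root_nonreal:
  fixes z :: complex and a b :: real
  assumes "of_real a + of_real b * z = 0" "Im z \<noteq> 0"
  shows "a = 0 \<and> b = 0"
proof -
  have "Im (of_real a + of_real b * z) = 0" "Re (of_real a + of_real b * z) = 0"
    using assms(1) by simp_all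
  thus ?thesis using assms(2) by simp
qed

text \<open>Eliminating \<open>z^2\<close> through the trace-norm relation leaves a real linear
  relation between 1 and \<open>z\<close>, which is trivial for nonreal \<open>z\<close>. Thus the
  quadratic is a multiple of \<open>X^2 - 2 Re z X + |z|^2\<close>.\<close>

lemma quadratic_root_nonreal:
  fixes z :: complex and a b c :: real
  assumes "of_real a + of_real b * z + of_real c * z\<^sup>2 = 0" "Im z \<noteq> 0"
  shows "b = - c * (2 * Re z) \<and> a = c * (cmod z)\<^sup>2"
proof -
  have "of_real (a - c * (cmod z)\<^sup>2) + of_real (b + c * (2 * Re z)) * z = 0"
    using assms(1) unfolding square_eq_trace_norm[of z] by (simp add: algebra_simps)
  from real_linear_root_nonreal[OF this assms(2)] show ?thesis by auto
qed

text \<open>Gauss's lemma: a primitive integral quadratic with root \<open>z\<close> divides the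
  monic integral polynomial with root \<open>z\<close>, so its leading coefficient is a unit and its
  other coefficients are trace and norm up to sign. Irreducibility enters only as the fact that no
  nonzero linear polynomial vanishes at a nonreal \<open>z\<close>.\<close>

lemma algebraic_int_nonreal_trace_norm:
  fixes z :: complex
  assumes "algebraic_int z" "Im z \<noteq> 0" "2 * Re z \<in> \<rat>" "(cmod z)\<^sup>2 \<in> \<rat>"
  shows "2 * Re z \<in> \<int> \<and> (cmod z)\<^sup>2 \<in> \<int>"
proof -
  let ?ev = "\<lambda>p :: int poly. poly (map_poly of_int p) z"
  from assms(1) obtain p :: "int poly" where p: "?ev p = 0" "lead_coeff p = 1"
    by (auto simp: algebraic_int_altdef_ipoly)
  obtain t1 t2 :: int where t: "2 * Re z = of_int t1 / of_int t2" "t2 > 0"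
    using Rats_cases'[OF assms(3)] by metis
  obtain n1 n2 :: int where n: "(cmod z)\<^sup>2 = of_int n1 / of_int n2" "n2 > 0"
    using Rats_cases'[OF assms(4)] by metis
  \<comment> \<open>The polynomial \<open>X^2 - 2 Re z X + |z|^2\<close>, multiplied by both
    denominators.\<close>
  define g0 where "g0 = [:n1 * t2, - t1 * n2, t2 * n2:]"
  have g0_nz: "g0 \<noteq> 0" and deg0: "degree g0 = 2" using t n by (auto simp: g0_def)
  note sq = square_eq_trace_norm[of z]
  have "?ev g0 = of_int (n1 * t2) - of_int (t1 * n2) * z + of_int (t2 * n2) * z\<^sup>2"
    by (simp add: g0_def map_poly_pCons algebra_simps power2_eq_square)
  also have "\<dots> = 0"
    unfolding sq t n using t(2) n(2) by (simp add: field_simps)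
  finally have ev0: "?ev g0 = 0" .
  define g where "g = primitive_part g0"
  have g0_eq: "g0 = smult (content g0) g" by (simp add: g_def)
  have cg: "content g = 1" and g_nz: "g \<noteq> 0" and deg: "degree g = 2"
    using g0_nz deg0 by (auto simp: g_def)
  have "of_int (content g0) * ?ev g = 0"
    using ev0 by (subst (asm) g0_eq) (simp add: map_poly_of_int_add map_poly_of_int_mult map_poly_of_int_smult)
  hence evg: "?ev g = 0" using g0_nz by simp
  define c where "c = lead_coeff g"
  obtain s r where sr: "pseudo_divmod p g = (s, r)" by force
  define k where "k = Suc (degree p) - degree g"
  \<comment> \<open>Pseudo-division keeps the coefficients integral at the price of the factor
    \<open>c ^ k\<close>, which a comparison of contents removes below.\<close>
  have eq: "smult (c ^ k) p = g * s + r" and dr: "r = 0 \<or> degree r < 2"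
    using pseudo_divmod[OF g_nz sr] by (auto simp: c_def k_def deg)
  have "?ev r = 0"
  proof -
    have "?ev (smult (c ^ k) p) = ?ev (g * s + r)" by (simp only: eq)
    thus ?thesis using p(1) evg by (simp add: map_poly_of_int_add map_poly_of_int_mult map_poly_of_int_smult)
  qed
  moreover have r_eq: "r = [:coeff r 0, coeff r 1:]"
    using dr by (intro poly_eqI) (auto simp: coeff_pCons coeff_eq_0 split: nat.splits)
  ultimately have "of_real (of_int (coeff r 0)) + of_real (of_int (coeff r 1)) * z = (0::complex)"
    by (subst (asm) r_eq) (simp add: map_poly_pCons algebra_simps)
  from real_linear_root_nonreal[OF this assms(2)] have "r = 0" by (subst r_eq) simp
  hence eq: "smult (c ^ k) p = g * s" using eq by simp
  have cp: "content p = 1"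
    using content_dvd_coeff[of p "degree p"] p(2) by (metis is_unit_content_iff)
  \<comment> \<open>Contents are multiplicative, and both \<open>g\<close> and the monic
    \<open>p\<close> have content 1; so \<open>c ^ k\<close> divides every coefficient of
    \<open>s\<close>.\<close>
  have "content s = normalize (c ^ k)"
    using arg_cong[OF eq, of content] by (simp add: content_mult cg cp)
  hence "c ^ k dvd content s" by simp
  hence "[:c ^ k:] dvd s" by (simp add: const_poly_dvd_iff_dvd_content)
  then obtain s' where s': "s = smult (c ^ k) s'" by (auto elim!: dvdE)
  have c_nz: "c \<noteq> 0" using g_nz by (simp add: c_def)
  have "smult (c ^ k) p = smult (c ^ k) (g * s')" using eq s' by simp
  hence "p = g * s'" using c_nz by (metis power_not_zero smult_cancel)
  hence "c * lead_coeff s' = 1" using p(2) by (simp add: c_def lead_coeff_mult)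
  hence "c = 1 \<or> c = -1" using zmult_eq_1_iff by blast
  hence cc: "of_int c * of_int c = (1::real)" by auto
  have g_eq: "g = [:coeff g 0, coeff g 1, c:]"
    using deg by (intro poly_eqI)
      (auto simp: coeff_pCons coeff_eq_0 c_def numeral_2_eq_2 split: nat.splits)
  have "of_real (of_int (coeff g 0)) + of_real (of_int (coeff g 1)) * z
        + of_real (of_int c) * z\<^sup>2 = (0::complex)"
    using evg by (subst (asm) g_eq) (simp add: map_poly_pCons algebra_simps power2_eq_square)
  from quadratic_root_nonreal[OF this assms(2)]
  have "of_int (coeff g 1) = - of_int c * (2 * Re z)" "of_int (coeff g 0) = of_int c * (cmod z)\<^sup>2"
    by auto
  hence "2 * Re z = of_int (- c * coeff g 1)" "(cmod z)\<^sup>2 = of_int (c * coeff g 0)"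
    using cc by (simp_all add: mult.assoc[symmetric])
  thus ?thesis by (metis Ints_of_int)
qed

lemma algebraic_int_of_trace_norm:
  fixes z :: complex
  assumes "2 * Re z \<in> \<int>" "(cmod z)\<^sup>2 \<in> \<int>"
  shows "algebraic_int z"
proof -
  obtain t n where tn: "2 * Re z = of_int t" "(cmod z)\<^sup>2 = of_int n"
    using assms by (auto elim!: Ints_cases)
  note sq = square_eq_trace_norm[of z]
  have "poly (map_poly of_int [:n, -t, 1:]) z = 0"
    using sq unfolding tn by (simp add: map_poly_pCons algebra_simps power2_eq_square)
  thus ?thesis by (auto simp: algebraic_int_altdef_ipoly intro!: exI[of _ "[:n, -t, 1:]"])
qed

section \<open>Quadratic fields and their integers in real coordinates\<close>

lemma quad_field_iff:
  assumes "d > 0"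
  shows "z \<in> quad_field d \<longleftrightarrow> Re z \<in> \<rat> \<and> Im z / sqrt (real d) \<in> \<rat>"
proof
  assume "z \<in> quad_field d"
  then obtain x y where "z = of_rat x + of_rat y * (\<i> * complex_of_real (sqrt (real d)))"
    by (auto simp: quad_field_def)
  hence "z = of_real (of_rat x) + of_real (of_rat y) * (\<i> * complex_of_real (sqrt (real d)))"
    by (simp only: complex_of_rat_eq)
  hence "Re z = of_rat x" "Im z = of_rat y * sqrt (real d)"
    by simp_all
  thus "Re z \<in> \<rat> \<and> Im z / sqrt (real d) \<in> \<rat>" using assms by simp
next
  assume "Re z \<in> \<rat> \<and> Im z / sqrt (real d) \<in> \<rat>"
  then obtain x y where "Re z = of_rat x" "Im z / sqrt (real d) = of_rat y"
    by (auto elim!: Rats_cases)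
  hence "z = of_real (of_rat x) + of_real (of_rat y) * (\<i> * complex_of_real (sqrt (real d)))"
    using assms by (simp add: complex_eq_iff field_simps)
  thus "z \<in> quad_field d" by (auto simp: quad_field_def complex_of_rat_eq)
qed

lemma quad_field_add:
  assumes "d > 0" "z \<in> quad_field d" "w \<in> quad_field d"
  shows "z + w \<in> quad_field d"
  using assms by (auto simp: quad_field_iff add_divide_distrib)

lemma quad_field_Rats_mult:
  assumes "d > 0" "z \<in> quad_field d" "x \<in> \<rat>"
  shows "complex_of_real x * z \<in> quad_field d"
  using assms by (auto simp: quad_field_iff simp flip: times_divide_eq_right)

text \<open>Both imaginary parts are rational multiples of \<open>sqrt d\<close>, so their product
  is rational. The case \<open>w = z\<close> is the norm.\<close>

lemma quad_field_norm_Rats: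
  assumes "d > 0" "z \<in> quad_field d" "w \<in> quad_field d"
  shows "Re (z * cnj w) \<in> \<rat>"
proof -
  have "Re (z * cnj w) = Re z * Re w + real d * ((Im z / sqrt (real d)) * (Im w / sqrt (real d)))"
    using assms(1) by (simp add: field_simps)
  also have "\<dots> \<in> \<rat>" using assms by (intro Rats_add Rats_mult) (auto simp: quad_field_iff)
  finally show ?thesis .
qed

text \<open>The polynomial argument settles nonreal elements; a real element of the field is
  rational, and a rational algebraic integer is an integer.\<close>

lemma ring_of_integers_quad_field_iff:
  assumes "d > 0"
  shows "z \<in> ring_of_integers (quad_field d) \<longleftrightarrow>
           z \<in> quad_field d \<and> 2 * Re z \<in> \<int> \<and> (cmod z)\<^sup>2 \<in> \<int>"
proof
  assume z: "z \<in> ring_of_integers (quad_field d)"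
  hence zK: "z \<in> quad_field d" and za: "algebraic_int z" by (auto simp: ring_of_integers_def)
  have "2 * Re z \<in> \<int> \<and> (cmod z)\<^sup>2 \<in> \<int>"
  proof (cases "Im z = 0")
    case True
    have "algebraic_int (Re z)"
      using za True by (metis algebraic_int_of_real_iff complex_eq_iff complex.sel complex_of_real_def)
    hence "Re z \<in> \<int>" using zK by (simp add: quad_field_iff[OF assms] rational_algebraic_int_is_int)
    thus ?thesis using True by (simp add: cmod_power2)
  next
    case False
    have "(cmod z)\<^sup>2 \<in> \<rat>"
      using quad_field_norm_Rats[OF assms zK zK] unfolding cmod_power2 by (simp add: power2_eq_square)
    thus ?thesis
      using algebraic_int_nonreal_trace_norm[OF za False] zK by (simp add: quad_field_iff[OF assms])
  qed
  thus "z \<in> quad_field d \<and> 2 * Re z \<in> \<int> \<and> (cmod z)\<^sup>2 \<in> \<int>" using zK by simp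
qed (auto simp: ring_of_integers_def algebraic_int_of_trace_norm)

lemma ring_of_integers_0: "d > 0 \<Longrightarrow> 0 \<in> ring_of_integers (quad_field d)"
  by (simp add: ring_of_integers_quad_field_iff quad_field_iff)

lemma ring_of_integers_Ints_mult:
  assumes "d > 0" "z \<in> ring_of_integers (quad_field d)" "k \<in> \<int>"
  shows "complex_of_real k * z \<in> ring_of_integers (quad_field d)"
proof -
  from assms(3) obtain m where m: "k = of_int m" by (auto elim: Ints_cases)
  have z: "z \<in> quad_field d" "2 * Re z \<in> \<int>" "(cmod z)\<^sup>2 \<in> \<int>"
    using assms by (auto simp: ring_of_integers_quad_field_iff)
  have "2 * Re (of_real k * z) = of_int m * (2 * Re z)" "(cmod (of_real k * z))\<^sup>2 = of_int (m^2) * (cmod z)\<^sup>2"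
    by (simp_all add: m norm_mult power_mult_distrib)
  hence "2 * Re (of_real k * z) \<in> \<int>" "(cmod (of_real k * z))\<^sup>2 \<in> \<int>"
    using z by (metis Ints_mult Ints_of_int)+
  thus ?thesis using z assms(1) quad_field_Rats_mult[of d z k]
    by (simp add: ring_of_integers_quad_field_iff m)
qed

text \<open>With \<open>s = 2 Re (z cnj w)\<close> one has \<open>\<bar>z + w\<bar>\<^sup>2 = \<bar>z\<bar>\<^sup>2 + \<bar>w\<bar>\<^sup>2 + s\<close>; the numbers \<open>s\<close> and
  \<open>2 Re (z w)\<close> are the roots of a monic integral quadratic, so the rational number \<open>s\<close> is an
  integer.\<close>

lemma ring_of_integers_add:
  assumes "d > 0" "z \<in> ring_of_integers (quad_field d)" "w \<in> ring_of_integers (quad_field d)"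
  shows "z + w \<in> ring_of_integers (quad_field d)"
proof -
  have z: "z \<in> quad_field d" "2 * Re z \<in> \<int>" "(cmod z)\<^sup>2 \<in> \<int>"
   and w: "w \<in> quad_field d" "2 * Re w \<in> \<int>" "(cmod w)\<^sup>2 \<in> \<int>"
    using assms by (auto simp: ring_of_integers_quad_field_iff)
  obtain t n t' n' :: int where
    tn: "2 * Re z = of_int t" "(cmod z)\<^sup>2 = of_int n" "2 * Re w = of_int t'" "(cmod w)\<^sup>2 = of_int n'"
    using z w by (auto elim!: Ints_cases)
  define s where "s = 2 * Re (z * cnj w)"
  \<comment> \<open>The product of \<open>2 Re (z cnj w)\<close> and \<open>2 Re (z w)\<close>,
    expanded by means of \<open>z^2 + (cnj z)^2 = t^2 - 2 n\<close> and its analogue for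
    \<open>w\<close>. Their sum is \<open>t * t'\<close>.\<close>
  define q where "q = n' * (t\<^sup>2 - 2 * n) + n * (t'\<^sup>2 - 2 * n')"
  have q: "of_int q = (cmod w)\<^sup>2 * ((2 * Re z)\<^sup>2 - 2 * (cmod z)\<^sup>2)
             + (cmod z)\<^sup>2 * ((2 * Re w)\<^sup>2 - 2 * (cmod w)\<^sup>2)"
    unfolding tn q_def by simp
  have "of_int q - of_int (t * t') * s + s\<^sup>2 = 0"
    unfolding q of_int_mult tn(1)[symmetric] tn(3)[symmetric] s_def cmod_power2
    by (simp add: algebra_simps power2_eq_square)
  hence "poly (map_poly of_int [:q, - (t * t'), 1:]) s = 0"
    by (simp add: map_poly_pCons algebra_simps power2_eq_square)
  hence "algebraic_int s"
    by (auto simp: algebraic_int_altdef_ipoly intro!: exI[of _ "[:q, - (t * t'), 1:]"])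
  moreover have "s \<in> \<rat>" unfolding s_def by (intro Rats_mult quad_field_norm_Rats[OF assms(1) z(1) w(1)]) simp
  ultimately have s: "s \<in> \<int>" by (rule rational_algebraic_int_is_int)
  have "(cmod (z + w))\<^sup>2 = (cmod z)\<^sup>2 + (cmod w)\<^sup>2 + s"
    unfolding cmod_power2 s_def by (simp add: power2_eq_square algebra_simps)
  hence "(cmod (z + w))\<^sup>2 \<in> \<int>" using z w s by simp
  moreover have "2 * Re (z + w) \<in> \<int>" using z w by (simp add: distrib_left)
  ultimately show ?thesis
    using quad_field_add[OF assms(1) z(1) w(1)] by (simp add: ring_of_integers_quad_field_iff assms(1))
qed

lemma ring_of_integers_minus:
  assumes "d > 0" "z \<in> ring_of_integers (quad_field d)" "w \<in> ring_of_integers (quad_field d)"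
  shows "z - w \<in> ring_of_integers (quad_field d)"
  using ring_of_integers_add[OF assms(1,2) ring_of_integers_Ints_mult[OF assms(1,3), of "-1"]] by simp

text \<open>The number is rational, and its square is an integral expression in trace and norm; a
  rational root of a monic integral polynomial is an integer.\<close>

lemma ring_of_integers_Im_Ints:
  assumes "d > 0" "z \<in> ring_of_integers (quad_field d)"
  shows "2 * sqrt (real d) * Im z \<in> \<int>"
proof -
  have z: "z \<in> quad_field d" "2 * Re z \<in> \<int>" "(cmod z)\<^sup>2 \<in> \<int>"
    using assms by (auto simp: ring_of_integers_quad_field_iff)
  have "2 * sqrt (real d) * Im z = 2 * real d * (Im z / sqrt (real d))"
    using assms(1) by (simp add: field_simps)
  also have "\<dots> \<in> \<rat>" using z assms(1) by (intro Rats_mult) (auto simp: quad_field_iff)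
  finally have rat: "2 * sqrt (real d) * Im z \<in> \<rat>" .
  have "(2 * sqrt (real d) * Im z)\<^sup>2 = real d * (4 * (cmod z)\<^sup>2 - (2 * Re z)\<^sup>2)"
    by (simp add: power_mult_distrib cmod_power2 algebra_simps)
  also have "\<dots> \<in> \<int>" by (intro Ints_mult Ints_diff Ints_power z) auto
  finally have "algebraic_int ((2 * sqrt (real d) * Im z)\<^sup>2)" by (rule int_imp_algebraic_int)
  hence "algebraic_int (2 * sqrt (real d) * Im z)"
    by (rule algebraic_int_root[where p = "monom 1 2"]) (auto simp: poly_monom degree_monom_eq)
  thus ?thesis using rat by (rule rational_algebraic_int_is_int)
qed

text \<open>The multiples of \<open>2 d k\<close> in the lattice of all numbers with integral coordinates
  \<open>2 Re z\<close> and \<open>2 sqrt d Im z\<close> are \<open>k\<close>-multiples of algebraic integers.\<close>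

lemma finite_quotient_ring_of_integers:
  assumes "d > 0" "k > (0::int)"
  shows "\<exists>f :: complex \<Rightarrow> int \<times> int. finite (range f) \<and>
           (\<forall>z \<in> ring_of_integers (quad_field d). \<forall>w \<in> ring_of_integers (quad_field d).
              f z = f w \<longrightarrow> (z - w) / of_int k \<in> ring_of_integers (quad_field d))"
proof -
  define M where "M = 2 * int d * k"
  have M: "M > 0" using assms by (simp add: M_def)
  \<comment> \<open>The floors only make \<open>f\<close> total: on the ring of integers both
    coordinates are already integers.\<close>
  define f where "f z = (\<lfloor>2 * Re z\<rfloor> mod M, \<lfloor>2 * sqrt (real d) * Im z\<rfloor> mod M)" for z
  have "range f \<subseteq> {0..<M} \<times> {0..<M}" using M by (auto simp: f_def)
  hence "finite (range f)" by (rule finite_subset) auto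
  moreover have "(z - w) / of_int k \<in> ring_of_integers (quad_field d)"
    if zwf: "z \<in> ring_of_integers (quad_field d)" "w \<in> ring_of_integers (quad_field d)" "f z = f w" for z w
  proof -
    obtain a b a' b' where
      ab: "2 * Re z = of_int a" "2 * sqrt (real d) * Im z = of_int b"
          "2 * Re w = of_int a'" "2 * sqrt (real d) * Im w = of_int b'"
      using zwf(1,2)[THEN ring_of_integers_Im_Ints[OF assms(1)]] zwf(1,2) assms(1)
      by (auto simp: ring_of_integers_quad_field_iff elim!: Ints_cases)
    have "a mod M = a' mod M" "b mod M = b' mod M"
      using zwf(3) by (simp_all add: f_def ab)
    then obtain u v where "a - a' = M * u" "b - b' = M * v"
      by (metis mod_eq_dvd_iff dvd_def)
    hence uv: "2 * Re (z - w) = of_int (M * u)" "2 * sqrt (real d) * Im (z - w) = of_int (M * v)"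
      using ab by (simp_all add: right_diff_distrib flip: of_int_diff)
    \<comment> \<open>Its coordinates turn out to be \<open>d * u\<close> and
      \<open>v * sqrt d\<close>, so \<open>y\<close> lies in the order generated by
      \<open>sqrt (-d)\<close>.\<close>
    define y where "y = (z - w) / of_int k"
    have Re: "Re y = of_int (int d * u)"
      using uv(1) assms by (simp add: y_def M_def field_simps)
    have Im: "Im y = sqrt (real d) * of_int v"
    proof -
      have "sqrt (real d) * Im y = real d * of_int v"
        using uv(2) assms by (simp add: y_def M_def field_simps)
      also have "\<dots> = sqrt (real d) * (sqrt (real d) * of_int v)" by simp
      finally show ?thesis using assms(1) by simp
    qed
    have "(cmod y)\<^sup>2 = of_int ((int d * u)\<^sup>2 + int d * v\<^sup>2)"
      unfolding cmod_power2 Re Im by (simp add: power_mult_distrib)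
    moreover have "2 * Re y = of_int (2 * int d * u)" by (simp add: Re)
    ultimately have "2 * Re y \<in> \<int>" "(cmod y)\<^sup>2 \<in> \<int>" by (metis Ints_of_int)+
    moreover have "y \<in> quad_field d" using assms(1) by (simp add: quad_field_iff Re Im)
    ultimately show ?thesis using assms(1) by (simp add: ring_of_integers_quad_field_iff y_def)
  qed
  ultimately show ?thesis by blast
qed

section \<open>Convergence of theta series\<close>

lemma summable_on_exp_minus_abs_int: "(\<lambda>m::int. exp (- \<bar>real_of_int m\<bar>)) summable_on UNIV"
proof -
  let ?f = "\<lambda>m::int. exp (- \<bar>real_of_int m\<bar>)"
  have "summable (\<lambda>n. exp (- 1 :: real) ^ n)" by (rule summable_geometric) simp
  hence "(\<lambda>n. exp (- 1 :: real) ^ n) summable_on UNIV"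
    by (subst summable_on_UNIV_nonneg_real_iff) auto
  hence geo: "(\<lambda>n. exp (- real n)) summable_on UNIV"
    by (simp flip: exp_of_nat_mult)
  have "?f summable_on range int"
    using geo by (subst summable_on_reindex) (auto simp: o_def)
  moreover have "?f summable_on range (\<lambda>n. - int n)"
    using geo by (subst summable_on_reindex) (auto simp: o_def inj_def)
  ultimately have sum: "?f summable_on (range int \<union> range (\<lambda>n. - int n))" by (rule summable_on_union)
  have "m \<in> range int \<union> range (\<lambda>n. - int n)" for m
    by (cases m rule: int_cases2) auto
  hence "range int \<union> range (\<lambda>n. - int n) = UNIV" by blast
  thus ?thesis using sum by simp
qed

text \<open>Completing squares bounds the exponent from below by \<open>\<bar>x\<bar> - C\<close>,
  so a two-sided geometric series dominates.\<close>

lemma summable_on_gaussian_int: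
  fixes c s \<alpha> :: real
  assumes "c > 0" "s \<noteq> 0"
  shows "(\<lambda>m::int. exp (- c * (s * of_int m + \<alpha>)\<^sup>2)) summable_on UNIV"
proof -
  \<comment> \<open>With \<open>k = c * s^2\<close>, the first summand pays for dropping the shift
    \<open>\<alpha>\<close>, the second for passing from \<open>k * x^2 / 2\<close> to
    \<open>\<bar>x\<bar>\<close>.\<close>
  define C where "C = c * \<alpha>\<^sup>2 + 1 / (2 * c * s\<^sup>2)"
  have bound: "\<bar>x\<bar> - C \<le> c * (s * x + \<alpha>)\<^sup>2" for x :: real
  proof -
    define k where "k = c * s\<^sup>2"
    have k: "k > 0" using assms by (simp add: k_def)
    have "c * (s * x + \<alpha>)\<^sup>2 - (k * x\<^sup>2 / 2 - c * \<alpha>\<^sup>2) = c / 2 * (s * x + 2 * \<alpha>)\<^sup>2"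
      by (simp add: k_def power2_eq_square algebra_simps)
    also have "\<dots> \<ge> 0" using assms by simp
    finally have 1: "k * x\<^sup>2 / 2 - c * \<alpha>\<^sup>2 \<le> c * (s * x + \<alpha>)\<^sup>2" by simp
    have "k * x\<^sup>2 / 2 - (\<bar>x\<bar> - 1 / (2 * k)) = (k * \<bar>x\<bar> - 1)\<^sup>2 / (2 * k)"
      using k by (simp add: power2_eq_square field_simps)
    also have "\<dots> \<ge> 0" using k by simp
    finally have "\<bar>x\<bar> - 1 / (2 * k) \<le> k * x\<^sup>2 / 2" by simp
    moreover have "C = c * \<alpha>\<^sup>2 + 1 / (2 * k)" by (simp add: C_def k_def mult.assoc)
    ultimately show ?thesis using 1 by linarith
  qed
  have "(\<lambda>m::int. norm (exp (- c * (s * of_int m + \<alpha>)\<^sup>2))) summable_on UNIV"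
  proof (rule Infinite_Sum.abs_summable_on_comparison_test')
    show "(\<lambda>m::int. exp C * exp (- \<bar>real_of_int m\<bar>)) summable_on UNIV"
      by (intro summable_on_cmult_right summable_on_exp_minus_abs_int)
    show "norm (exp (- c * (s * of_int m + \<alpha>)\<^sup>2)) \<le> exp C * exp (- \<bar>real_of_int m\<bar>)" for m
      using bound[of "of_int m"] by (simp flip: exp_add)
  qed
  thus ?thesis by simp
qed

text \<open>The coordinates \<open>2 Re z\<close> and \<open>2 sqrt d Im z\<close> embed the ring
  into pairs of integers, where the Gaussian factors into two one-dimensional ones.\<close>

lemma summable_on_gaussian_ring_of_integers:
  assumes "d > 0" "c > 0"
  shows "(\<lambda>z. exp (- c * (cmod (z + \<alpha>))\<^sup>2)) summable_on ring_of_integers (quad_field d)"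
proof -
  let ?O = "ring_of_integers (quad_field d)"
  define g1 where "g1 m = exp (- c * (1 / 2 * of_int m + Re \<alpha>)\<^sup>2)" for m :: int
  define g2 where "g2 m = exp (- c * (1 / (2 * sqrt (real d)) * of_int m + Im \<alpha>)\<^sup>2)" for m :: int
  define h where "h = (\<lambda>(m, n). g1 m * g2 n)"
  define \<phi> where "\<phi> z = (\<lfloor>2 * Re z\<rfloor>, \<lfloor>2 * sqrt (real d) * Im z\<rfloor>)" for z
  have g: "g1 summable_on UNIV" "g2 summable_on UNIV"
    unfolding g1_def g2_def using assms by (intro summable_on_gaussian_int; simp)+
  have "h summable_on (UNIV \<times> UNIV)"
  proof (rule summable_on_SigmaI)
    show "((\<lambda>n. h (m, n)) has_sum g1 m * infsum g2 UNIV) UNIV" for m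
      unfolding h_def prod.case using g by (intro has_sum_cmult_right has_sum_infsum)
    show "(\<lambda>m. g1 m * infsum g2 UNIV) summable_on UNIV"
      using g by (intro summable_on_cmult_left)
  qed (auto simp: h_def g1_def g2_def)
  \<comment> \<open>The image of the ring need not be identified: a subfamily of a summable family
    is summable.\<close>
  hence "h summable_on (\<phi> ` ?O)" by (rule summable_on_subset_banach) auto
  have coord: "Re z = 1 / 2 * of_int (fst (\<phi> z))" "Im z = 1 / (2 * sqrt (real d)) * of_int (snd (\<phi> z))"
    if "z \<in> ?O" for z
    using that ring_of_integers_Im_Ints[OF assms(1) that] assms(1)
    by (auto simp: \<phi>_def ring_of_integers_quad_field_iff elim!: Ints_cases)
  have "inj_on \<phi> ?O"
    by (intro inj_onI) (metis coord complex_eqI)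
  hence "(h \<circ> \<phi>) summable_on ?O"
    using \<open>h summable_on (\<phi> ` ?O)\<close> by (simp add: summable_on_reindex)
  moreover have "(h \<circ> \<phi>) z = exp (- c * (cmod (z + \<alpha>))\<^sup>2)" if "z \<in> ?O" for z
  proof -
    have "(h \<circ> \<phi>) z = exp (- c * (Re z + Re \<alpha>)\<^sup>2) * exp (- c * (Im z + Im \<alpha>)\<^sup>2)"
      unfolding coord[OF that] by (simp add: h_def g1_def g2_def case_prod_unfold)
    also have "\<dots> = exp (- c * (cmod (z + \<alpha>))\<^sup>2)"
      unfolding cmod_power2 by (simp add: algebra_simps flip: exp_add)
    finally show ?thesis .
  qed
  ultimately show ?thesis by (simp cong: summable_on_cong)
qed

section \<open>Products of absolutely convergent series\<close>

text \<open>A finite set of choice functions lies in a finite box, over which the sum of products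
  factors. The product of the full sums therefore bounds all finite partial sums.\<close>

lemma abs_summable_on_prod_PiE:
  fixes f :: "'a \<Rightarrow> 'b \<Rightarrow> 'c :: {real_normed_div_algebra, comm_semiring_1}"
  assumes "finite A" "\<And>x. x \<in> A \<Longrightarrow> (\<lambda>y. norm (f x y)) summable_on B x"
  shows "(\<lambda>g. norm (\<Prod>x\<in>A. f x (g x))) summable_on PiE A B"
  unfolding abs_summable_iff_bdd_above
proof (rule bdd_aboveI2)
  fix F assume "F \<in> {F. F \<subseteq> PiE A B \<and> finite F}"
  hence F: "F \<subseteq> PiE A B" "finite F" by auto
  \<comment> \<open>The projections of \<open>F\<close>, whose product is the box enclosing
    it.\<close>
  define B' where "B' x = (\<lambda>g. g x) ` F" for x
  have B': "finite (B' x)" for x using F by (simp add: B'_def)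
  have FB: "F \<subseteq> PiE A B'" using F(1) by (auto simp: B'_def PiE_iff)
  have "(\<Sum>g\<in>F. norm (\<Prod>x\<in>A. f x (g x))) \<le> (\<Sum>g\<in>PiE A B'. norm (\<Prod>x\<in>A. f x (g x)))"
    using FB B' assms(1) by (intro sum_mono2 finite_PiE) auto
  also have "\<dots> = (\<Prod>x\<in>A. \<Sum>y\<in>B' x. norm (f x y))"
    using prod_sum_PiE[of A B' "\<lambda>x y. norm (f x y)"] assms(1) B' by (simp add: prod_norm)
  also have "\<dots> \<le> (\<Prod>x\<in>A. infsum (\<lambda>y. norm (f x y)) (B x))"
  proof (intro prod_mono conjI)
    fix x assume x: "x \<in> A"
    show "(\<Sum>y\<in>B' x. norm (f x y)) \<le> infsum (\<lambda>y. norm (f x y)) (B x)"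
      using F(1) x B' assms(2)[OF x] by (intro finite_sum_le_infsum) (auto simp: B'_def)
  qed (auto intro: sum_nonneg)
  finally show "(\<Sum>g\<in>F. norm (\<Prod>x\<in>A. f x (g x))) \<le> (\<Prod>x\<in>A. infsum (\<lambda>y. norm (f x y)) (B x))" .
qed

lemma bij_betw_vec_nth_vec_over: "bij_betw vec_nth (vec_over S) (PiE UNIV (\<lambda>_. S))"
  by (rule bij_betwI[where g = vec_lambda]) (auto simp: vec_over_def)

lemma bij_betw_columns_mat_over:
  "bij_betw (\<lambda>N j. column j N) (mat_over S) (PiE UNIV (\<lambda>_. vec_over S))"
  by (rule bij_betwI[where g = "\<lambda>f. \<chi> i j. f j $ i"])
     (auto simp: mat_over_def vec_over_def column_def vec_eq_iff fun_eq_iff PiE_iff)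

text \<open>Choosing one vector for each \<open>j\<close> is the same as choosing a matrix by its
  columns, so multiplying out the series gives a single sum over matrices.\<close>

lemma has_sum_prod_columns:
  fixes f :: "'h::finite \<Rightarrow> complex ^ 'g \<Rightarrow> complex"
  assumes "\<And>j. (\<lambda>v. norm (f j v)) summable_on vec_over S"
  shows "((\<lambda>N. \<Prod>j\<in>UNIV. f j (column j N)) has_sum (\<Prod>j\<in>UNIV. infsum (f j) (vec_over S))) (mat_over S)"
proof -
  let ?F = "\<lambda>g. \<Prod>j\<in>UNIV. f j (g j)"
  have "(\<lambda>g. norm (?F g)) summable_on PiE UNIV (\<lambda>_. vec_over S)"
    using assms by (intro abs_summable_on_prod_PiE) auto
  hence "(?F has_sum infsum ?F (PiE UNIV (\<lambda>_. vec_over S))) (PiE UNIV (\<lambda>_. vec_over S))"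
    by (rule has_sum_infsum[OF abs_summable_summable])
  also have "infsum ?F (PiE UNIV (\<lambda>_. vec_over S)) = (\<Prod>j\<in>UNIV. infsum (f j) (vec_over S))"
    using assms by (intro infsum_prod_PiE_abs) auto
  finally show ?thesis
    using has_sum_reindex_bij_betw[OF bij_betw_columns_mat_over[of S], of ?F] by simp
qed

section \<open>Hermitian forms on the upper half space and convergence of theta series\<close>

text \<open>The form of the conjugate transpose takes the conjugate value, so the difference of the
  two forms is \<open>2 * \<i>\<close> times the imaginary part.\<close>

lemma sesq_imaginary_part:
  "sesq z ((\<chi> i j. (W - conj_transpose W) $ i $ j / (2 * \<i>)) *v z) = of_real (Im (sesq z (W *v z)))"
proof -
  define Q where "Q = sesq z (W *v z)"
  have Q: "Q = (\<Sum>i\<in>UNIV. \<Sum>j\<in>UNIV. cnj (z $ i) * W $ i $ j * z $ j)"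
    by (simp add: Q_def sesq_def matrix_vector_mult_def sum_distrib_left mult.assoc)
  have "cnj Q = (\<Sum>j\<in>UNIV. \<Sum>i\<in>UNIV. z $ j * cnj (W $ j $ i) * cnj (z $ i))"
    by (simp add: Q)
  also have "\<dots> = (\<Sum>i\<in>UNIV. \<Sum>j\<in>UNIV. cnj (z $ i) * cnj (W $ j $ i) * z $ j)"
    by (subst sum.swap) (simp add: mult_ac)
  finally have cQ: "cnj Q = (\<Sum>i\<in>UNIV. \<Sum>j\<in>UNIV. cnj (z $ i) * cnj (W $ j $ i) * z $ j)" .
  have distr: "x * ((u - v) / (2 * \<i>) * y) = (x * u * y - x * v * y) / (2 * \<i>)" for x u v y :: complex
    by (simp add: left_diff_distrib right_diff_distrib mult.assoc)
  have "sesq z ((\<chi> i j. (W - conj_transpose W) $ i $ j / (2 * \<i>)) *v z) =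
      (\<Sum>i\<in>UNIV. \<Sum>j\<in>UNIV. cnj (z $ i) * ((W $ i $ j - cnj (W $ j $ i)) / (2 * \<i>) * z $ j))"
    by (simp only: sesq_def matrix_vector_mult_def conj_transpose_def sum_distrib_left
          vec_lambda_beta vector_minus_component)
  also have "\<dots> = (Q - cnj Q) / (2 * \<i>)"
    unfolding cQ unfolding Q distr by (simp only: sum_divide_distrib diff_divide_distrib sum_subtractf)
  also have "\<dots> = of_real (Im Q)" unfolding complex_diff_cnj by (simp add: complex_eq_iff)
  finally show ?thesis by (simp add: Q_def)
qed

lemma sesq_scaleR_matrix: "sesq z ((c *\<^sub>R W) *v z) = of_real c * sesq z (W *v z)"
  by (simp add: sesq_def matrix_vector_mult_def sum_distrib_left scaleR_conv_of_real[where 'a = complex] mult_ac)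

lemma sesq_scaleR_vector: "sesq (c *\<^sub>R z) (W *v (c *\<^sub>R z)) = of_real (c\<^sup>2) * sesq z (W *v z)"
  by (simp add: sesq_def matrix_vector_mult_def sum_distrib_left scaleR_conv_of_real[where 'a = complex] power2_eq_square mult_ac)

lemma upper_half_space_Im_pos:
  assumes "W \<in> hermitian_upper_half_space" "z \<noteq> 0"
  shows "Im (sesq z (W *v z)) > 0"
proof -
  have "Re (sesq z ((\<chi> i j. (W - conj_transpose W) $ i $ j / (2 * \<i>)) *v z)) > 0"
    using assms unfolding hermitian_upper_half_space_def hermitian_pos_def_def by blast
  thus ?thesis unfolding sesq_imaginary_part by simp
qed

text \<open>The form attains a positive minimum on the compact unit sphere; homogeneity of degree
  two extends the bound to all vectors.\<close>

lemma upper_half_space_coercive: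
  fixes W :: "complex ^ 'g ^ 'g"
  assumes W: "W \<in> hermitian_upper_half_space"
  shows "\<exists>c>0. \<forall>z. Im (sesq z (W *v z)) \<ge> c * (norm z)\<^sup>2"
proof -
  let ?q = "\<lambda>z. Im (sesq z (W *v z))"
  have "continuous_on (sphere 0 1) ?q"
    unfolding sesq_def matrix_vector_mult_def by (simp, intro continuous_intros)
  moreover have "sphere (0 :: complex ^ 'g) 1 \<noteq> {}" by simp
  ultimately obtain u where u: "u \<in> sphere 0 1" "\<And>v. v \<in> sphere 0 1 \<Longrightarrow> ?q u \<le> ?q v"
    using continuous_attains_inf[OF compact_sphere, of "0 :: complex ^ 'g" 1 ?q] by blast
  have "?q u > 0" using u(1) by (intro upper_half_space_Im_pos[OF W]) auto
  moreover have "?q u * (norm z)\<^sup>2 \<le> ?q z" for z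
  proof (cases "z = 0")
    case True thus ?thesis by (simp add: sesq_def)
  next
    case False
    define v where "v = z /\<^sub>R norm z"
    have zv: "z = norm z *\<^sub>R v" and "v \<in> sphere 0 1" using False by (auto simp: v_def)
    have "?q z = (norm z)\<^sup>2 * ?q v"
      by (subst (1 2) zv) (simp add: sesq_scaleR_vector del: of_real_power)
    thus ?thesis using u(2)[OF \<open>v \<in> sphere 0 1\<close>] by (simp add: mult.commute mult_right_mono)
  qed
  ultimately show ?thesis by blast
qed

text \<open>The linear term of the exponent is purely imaginary and does not affect the norm.
  Coercivity bounds the quadratic term by a sum over coordinates, so a product of one-variable
  Gaussians over the ring of integers dominates.\<close>

lemma Theta_vec_abs_summable:
  fixes W :: "complex ^ 'g ^ 'g"
  assumes "d > 0" "W \<in> hermitian_upper_half_space" "l > 0"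
  shows "(\<lambda>n. norm (exp (complex_of_real pi * \<i> * sesq (n + a) ((l *\<^sub>R W) *v (n + a))
             + 2 * complex_of_real pi * \<i> * complex_of_real (Re (sesq (n + a) b)))))
         summable_on vec_over (ring_of_integers (quad_field d))"
proof -
  let ?O = "ring_of_integers (quad_field d)"
  obtain c where c: "c > 0" "\<And>z. Im (sesq z (W *v z)) \<ge> c * (norm z)\<^sup>2"
    using upper_half_space_coercive[OF assms(2)] by auto
  define e where "e = pi * l * c"
  have e: "e > 0" using c assms by (simp add: e_def)
  define f where "f i z = exp (- e * (cmod (z + a $ i))\<^sup>2)" for i z
  have "(\<lambda>g. norm (\<Prod>i\<in>UNIV. f i (g i))) summable_on PiE UNIV (\<lambda>_. ?O)"
    using summable_on_gaussian_ring_of_integers[OF assms(1) e]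
    by (intro abs_summable_on_prod_PiE) (auto simp: f_def)
  hence sum: "(\<lambda>n. norm (\<Prod>i\<in>UNIV. f i (n $ i))) summable_on vec_over ?O"
    using summable_on_reindex_bij_betw[OF bij_betw_vec_nth_vec_over[of ?O],
        where f = "\<lambda>g. norm (\<Prod>i\<in>UNIV. f i (g i))"] by simp
  show ?thesis
  proof (rule Infinite_Sum.abs_summable_on_comparison_test'[OF sum])
    fix n :: "complex ^ 'g"
    have "norm (exp (complex_of_real pi * \<i> * sesq (n + a) ((l *\<^sub>R W) *v (n + a))
             + 2 * complex_of_real pi * \<i> * complex_of_real (Re (sesq (n + a) b))))
          = exp (- pi * l * Im (sesq (n + a) (W *v (n + a))))"
      by (simp add: sesq_scaleR_matrix)
    also have "\<dots> \<le> exp (- e * (norm (n + a))\<^sup>2)"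
      using c(2)[of "n + a"] assms(3) by (simp add: e_def mult.assoc)
    also have "(norm (n + a))\<^sup>2 = (\<Sum>i\<in>UNIV. (cmod (n $ i + a $ i))\<^sup>2)"
      by (simp add: norm_vec_def L2_set_def sum_nonneg)
    also have "exp (- e * \<dots>) = norm (\<Prod>i\<in>UNIV. f i (n $ i))"
      by (simp add: f_def prod_norm[symmetric] sum_distrib_left flip: exp_sum sum_negf)
    finally show "norm (exp (complex_of_real pi * \<i> * sesq (n + a) ((l *\<^sub>R W) *v (n + a))
             + 2 * complex_of_real pi * \<i> * complex_of_real (Re (sesq (n + a) b))))
          \<le> norm (\<Prod>i\<in>UNIV. f i (n $ i))" .
  qed
qed

section \<open>Integral diagonalization of rational quadratic forms\<close>

lemma Rats_bilinear:
  fixes P :: "real ^ 'm ^ 'n"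
  assumes "P \<in> mat_over \<rat>" "x \<in> vec_over \<rat>" "y \<in> vec_over \<rat>"
  shows "x \<bullet> (P *v y) \<in> \<rat>"
  using assms unfolding inner_vec_def matrix_vector_mult_def mat_over_def vec_over_def
  by (auto intro!: Rats_sum Rats_mult)

lemma symmetric_bilinear_commute:
  fixes P :: "real ^ 'n ^ 'n"
  assumes "transpose P = P"
  shows "x \<bullet> (P *v y) = y \<bullet> (P *v x)"
  by (metis assms dot_lmul_matrix inner_commute transpose_matrix_vector)

text \<open>Gram-Schmidt by induction on the set of coordinates. The support condition replaces
  linear independence: the earlier vectors vanish at the new coordinate \<open>j\<close>, so the new
  vector keeps the entry 1 there and is nonzero.\<close>

lemma rational_orthogonal_family:
  fixes P :: "real ^ 'h ^ 'h" and J :: "'h set"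
  assumes P: "P \<in> mat_over \<rat>" "symmetric_pos_def P"
  shows "\<exists>v :: 'h \<Rightarrow> real ^ 'h.
           (\<forall>j\<in>J. v j \<in> vec_over \<rat> \<and> (\<forall>i. i \<notin> J \<longrightarrow> v j $ i = 0) \<and> v j \<noteq> 0) \<and>
           (\<forall>j\<in>J. \<forall>k\<in>J. j \<noteq> k \<longrightarrow> v j \<bullet> (P *v v k) = 0)"
  using finite_class.finite[of J]
proof (induction J rule: finite_induct)
  case empty
  show ?case by simp
next
  case (insert j J)
  then obtain v :: "'h \<Rightarrow> real ^ 'h" where
    v: "\<And>k. k \<in> J \<Longrightarrow> v k \<in> vec_over \<rat>" "\<And>k i. k \<in> J \<Longrightarrow> i \<notin> J \<Longrightarrow> v k $ i = 0"
       "\<And>k. k \<in> J \<Longrightarrow> v k \<noteq> 0"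
       "\<And>k l. k \<in> J \<Longrightarrow> l \<in> J \<Longrightarrow> k \<noteq> l \<Longrightarrow> v k \<bullet> (P *v v l) = 0"
    by metis
  define e :: "real ^ 'h" where "e = axis j 1"
  define c where "c k = (e \<bullet> (P *v v k)) / (v k \<bullet> (P *v v k))" for k
  \<comment> \<open>The coordinate vector minus its orthogonal projection; the denominators in
    \<open>c\<close> are positive because \<open>P\<close> is positive-definite.\<close>
  define w where "w = e - (\<Sum>k\<in>J. c k *\<^sub>R v k)"
  have e: "e \<in> vec_over \<rat>" by (simp add: e_def vec_over_def axis_def)
  have c: "c k \<in> \<rat>" if "k \<in> J" for k
    using that unfolding c_def by (intro Rats_divide Rats_bilinear P e v)
  have w_nth: "w $ i = e $ i - (\<Sum>k\<in>J. c k * v k $ i)" for i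
    by (simp add: w_def)
  have w1: "w \<in> vec_over \<rat>"
    using e c v(1) unfolding vec_over_def mem_Collect_eq w_nth
    by (intro allI Rats_diff Rats_sum Rats_mult) auto
  have w2: "w $ i = 0" if "i \<notin> insert j J" for i
    using that v(2) by (simp add: w_nth e_def axis_def)
  have "w $ j = 1"
    using insert.hyps v(2) by (simp add: w_nth e_def)
  hence w3: "w \<noteq> 0" by auto
  have w4: "w \<bullet> (P *v v l) = 0" if l: "l \<in> J" for l
  proof -
    have "(\<Sum>k\<in>J. c k * (v k \<bullet> (P *v v l))) = (\<Sum>k\<in>J. if k = l then c l * (v l \<bullet> (P *v v l)) else 0)"
      using v(4) l by (intro sum.cong) auto
    also have "\<dots> = c l * (v l \<bullet> (P *v v l))" using l insert.hyps by simp
    also have "\<dots> = e \<bullet> (P *v v l)"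
      using P(2) v(3)[OF l] unfolding symmetric_pos_def_def c_def
      by (metis less_irrefl nonzero_eq_divide_eq)
    finally show ?thesis by (simp add: w_def inner_diff_left inner_sum_left)
  qed
  have w5: "v l \<bullet> (P *v w) = 0" if l: "l \<in> J" for l
    using w4[OF l] symmetric_bilinear_commute[of P w "v l"] P(2) by (simp add: symmetric_pos_def_def)
  show ?case
    using v w1 w2 w3 w4 w5 insert.hyps
    by (intro exI[of _ "v(j := w)"]) auto
qed

lemma common_denominator:
  fixes X :: "real set"
  assumes "finite X" "X \<subseteq> \<rat>"
  shows "\<exists>k::int. k > 0 \<and> (\<forall>x\<in>X. of_int k * x \<in> \<int>)"
  using assms
proof (induction X rule: finite_induct)
  case empty
  show ?case by (auto intro: exI[of _ 1])
next
  case (insert x X)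
  then obtain k :: int where k: "k > 0" "\<And>y. y \<in> X \<Longrightarrow> of_int k * y \<in> \<int>" by auto
  from insert.prems have "x \<in> \<rat>" by simp
  then obtain a b :: int where ab: "x = of_int a / of_int b" "b > 0" by (metis Rats_cases')
  have "of_int (k * b) * x = of_int (k * a)" using ab by simp
  hence "of_int (k * b) * x \<in> \<int>" by (metis Ints_of_int)
  moreover have "of_int (k * b) * y \<in> \<int>" if "y \<in> X" for y
  proof -
    have "of_int (k * b) * y = of_int b * (of_int k * y)" by simp
    also have "\<dots> \<in> \<int>" by (intro Ints_mult k(2)[OF that]) auto
    finally show ?thesis .
  qed
  ultimately show ?case using k ab by (intro exI[of _ "k * b"]) auto
qed

lemma common_denominator_matrix:
  fixes M :: "real ^ 'n ^ 'm"
  assumes "M \<in> mat_over \<rat>"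
  shows "\<exists>k::int. k > 0 \<and> of_int k *\<^sub>R M \<in> mat_over \<int>"
proof -
  have "finite (range (\<lambda>(i, j). M $ i $ j))" by simp
  moreover have "range (\<lambda>(i, j). M $ i $ j) \<subseteq> \<rat>" using assms by (auto simp: mat_over_def)
  ultimately obtain k :: int where "k > 0" "\<forall>x \<in> range (\<lambda>(i, j). M $ i $ j). of_int k * x \<in> \<int>"
    using common_denominator by blast
  thus ?thesis by (intro exI[of _ k]) (auto simp: mat_over_def)
qed

lemma Rats_matrix_mult:
  fixes M :: "real ^ 'n ^ 'm" and N :: "real ^ 'k ^ 'n"
  assumes "M \<in> mat_over \<rat>" "N \<in> mat_over \<rat>"
  shows "M ** N \<in> mat_over \<rat>"
  using assms unfolding mat_over_def matrix_matrix_mult_def by (auto intro!: Rats_sum Rats_mult)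

text \<open>The rows of \<open>S\<close> are the orthogonal vectors scaled by a common denominator.
  Integrality of \<open>S\<close> will keep the lattice \<open>L S\<close> inside \<open>L\<close>,
  and rationality of the inverse \<open>T\<close> will make its index finite.\<close>

lemma integral_diagonalization:
  fixes P :: "real ^ 'h ^ 'h"
  assumes P: "P \<in> mat_over \<rat>" "symmetric_pos_def P"
  shows "\<exists>(S :: real ^ 'h ^ 'h) T (lam :: 'h \<Rightarrow> rat).
           S \<in> mat_over \<int> \<and> T \<in> mat_over \<rat> \<and> S ** T = mat 1 \<and> T ** S = mat 1 \<and> (\<forall>j. lam j > 0) \<and>
           S ** P ** transpose S = (\<chi> i j. if i = j then of_rat (lam i) else 0)"
proof -
  obtain v :: "'h \<Rightarrow> real ^ 'h" where
    v: "\<And>j. v j \<in> vec_over \<rat>" "\<And>j. v j \<noteq> 0" "\<And>j k. j \<noteq> k \<Longrightarrow> v j \<bullet> (P *v v k) = 0"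
    using rational_orthogonal_family[OF P, of UNIV] by auto
  have "(\<chi> i. v i) \<in> mat_over \<rat>" using v(1) by (simp add: mat_over_def vec_over_def)
  then obtain k :: int where k: "k > 0" "of_int k *\<^sub>R (\<chi> i. v i) \<in> mat_over \<int>"
    using common_denominator_matrix by blast
  define S :: "real ^ 'h ^ 'h" where "S = of_int k *\<^sub>R (\<chi> i. v i)"
  have S: "S \<in> mat_over \<int>" using k by (simp add: S_def)
  have S_row: "S $ i = of_int k *\<^sub>R v i" for i by (simp add: S_def)
  have SPS: "(S ** P ** transpose S) $ i $ j = S $ i \<bullet> (P *v S $ j)" for i j
  proof -
    have "(S ** P ** transpose S) $ i $ j = (\<Sum>l\<in>UNIV. \<Sum>m\<in>UNIV. S $ i $ m * P $ m $ l * S $ j $ l)"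
      by (simp add: matrix_matrix_mult_def transpose_def sum_distrib_right)
    also have "\<dots> = (\<Sum>m\<in>UNIV. \<Sum>l\<in>UNIV. S $ i $ m * P $ m $ l * S $ j $ l)" by (rule sum.swap)
    also have "\<dots> = S $ i \<bullet> (P *v S $ j)"
      by (simp add: inner_vec_def matrix_vector_mult_def sum_distrib_left mult.assoc)
    finally show ?thesis .
  qed
  have off: "(S ** P ** transpose S) $ i $ j = 0" if "i \<noteq> j" for i j
    using v(3)[OF that] unfolding SPS by (simp add: S_row matrix_vector_mult_scaleR)
  have S_nz: "S $ i \<noteq> 0" for i using v(2)[of i] k by (simp add: S_row)
  define \<mu> where "\<mu> i = S $ i \<bullet> (P *v S $ i)" for i
  have \<mu>_pos: "\<mu> i > 0" for i using P(2) S_nz[of i] by (simp add: symmetric_pos_def_def \<mu>_def)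
  have S_rat: "S \<in> mat_over \<rat>" using S Ints_subset_Rats by (auto simp: mat_over_def)
  have \<mu>_rat: "\<mu> i \<in> \<rat>" for i
    using S_rat unfolding \<mu>_def by (intro Rats_bilinear P) (auto simp: mat_over_def vec_over_def)
  have "\<forall>i. \<exists>q. \<mu> i = of_rat q" using \<mu>_rat by (auto elim: Rats_cases)
  then obtain lam where lam: "\<And>i. \<mu> i = of_rat (lam i)" by metis
  have diag: "S ** P ** transpose S = (\<chi> i j. if i = j then of_rat (lam i) else 0)"
    using off lam by (auto simp: vec_eq_iff SPS \<mu>_def)
  \<comment> \<open>The inverse is read off from the diagonalization: \<open>S\<close> times
    \<open>P S^t\<close> is diagonal with entries \<open>\<mu> i\<close>, which are then
    inverted.\<close>
  define T where "T = P ** transpose S ** (\<chi> i j. if i = j then 1 / \<mu> i else 0)"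
  have T: "T \<in> mat_over \<rat>"
    unfolding T_def using S_rat \<mu>_rat
    by (intro Rats_matrix_mult P) (auto simp: mat_over_def transpose_def)
  have "S ** T = (\<chi> i j. if i = j then of_rat (lam i) else 0) ** (\<chi> i j. if i = j then 1 / \<mu> i else 0)"
    unfolding T_def diag[symmetric] by (simp only: matrix_mul_assoc)
  also have "\<dots> = mat 1"
    using \<mu>_pos by (auto simp: vec_eq_iff matrix_matrix_mult_def mat_def if_distrib[of "\<lambda>x. x * _"]
        lam[symmetric] less_imp_neq[symmetric] cong: if_cong)
  finally have ST: "S ** T = mat 1" .
  hence TS: "T ** S = mat 1" by (simp add: matrix_left_right_inverse)
  have "lam j > 0" for j using \<mu>_pos[of j] by (simp add: lam)
  thus ?thesis using S T ST TS diag by blast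
qed

section \<open>Sums of squarefree monomials\<close>

text \<open>Evaluating two polynomials and their sum over one common set of monomials avoids
  tracking terms that cancel.\<close>

lemma mpoly_eval_superset:
  assumes "finite A" "Poly_Mapping.keys p \<subseteq> A"
  shows "mpoly_eval p f = (\<Sum>m\<in>A. of_rat (Poly_Mapping.lookup p m) *
           (\<Prod>v\<in>Poly_Mapping.keys m. f v ^ Poly_Mapping.lookup m v))"
  unfolding mpoly_eval_def using assms
  by (intro sum.mono_neutral_left) (auto simp: in_keys_iff)

lemma mpoly_eval_add: "mpoly_eval (p + q) f = mpoly_eval p f + mpoly_eval q f"
proof -
  let ?A = "Poly_Mapping.keys p \<union> Poly_Mapping.keys q"
  have A: "finite ?A" by simp
  show ?thesis
    unfolding mpoly_eval_superset[OF A keys_add] mpoly_eval_superset[OF A Un_upper1]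
      mpoly_eval_superset[OF A Un_upper2]
    by (simp add: lookup_add of_rat_add distrib_right sum.distrib)
qed

lemma mpoly_vars_add: "mpoly_vars (p + q) \<subseteq> mpoly_vars p \<union> mpoly_vars q"
  unfolding mpoly_vars_def using keys_add[of p q] by blast

lemma mpoly_homogeneous_add:
  "mpoly_homogeneous n p \<Longrightarrow> mpoly_homogeneous n q \<Longrightarrow> mpoly_homogeneous n (p + q)"
  unfolding mpoly_homogeneous_def using keys_add[of p q] by blast

lemma lookup_sum_single_inj:
  assumes "inj (x :: 'h::finite \<Rightarrow> 'v)"
  shows "Poly_Mapping.lookup (\<Sum>j\<in>UNIV. Poly_Mapping.single (x j) (1::nat)) v = (if v \<in> range x then 1 else 0)"
proof -
  have "Poly_Mapping.lookup (\<Sum>j\<in>UNIV. Poly_Mapping.single (x j) (1::nat)) v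
          = (\<Sum>j\<in>UNIV. if x j = v then 1 else 0)"
    by (simp add: lookup_sum lookup_single when_def del: One_nat_def)
  also have "\<dots> = card {j. x j = v}" by (simp add: sum.If_cases)
  also have "\<dots> = (if v \<in> range x then 1 else 0)"
  proof (cases "v \<in> range x")
    case True
    then obtain i where "v = x i" by auto
    hence "{j. x j = v} = {i}" using assms by (auto simp: inj_def)
    thus ?thesis using True by simp
  qed auto
  finally show ?thesis .
qed

text \<open>Injectivity makes every exponent 0 or 1, so the degree counts the
  indeterminates.\<close>

lemma squarefree_monomial_mpoly:
  fixes x :: "'h::finite \<Rightarrow> 'v"
  assumes "inj x"
  shows "\<exists>p. mpoly_homogeneous CARD('h) p \<and> mpoly_vars p = range x \<and>
             (\<forall>f. mpoly_eval p f = (\<Prod>j\<in>UNIV. f (x j)))"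
proof -
  define m where "m = (\<Sum>j\<in>UNIV. Poly_Mapping.single (x j) (1::nat))"
  have lookup: "Poly_Mapping.lookup m v = (if v \<in> range x then 1 else 0)" for v
    unfolding m_def by (rule lookup_sum_single_inj[OF assms])
  have keys: "Poly_Mapping.keys m = range x"
    by (auto simp: in_keys_iff lookup split: if_splits)
  define p where "p = Poly_Mapping.single m (1::rat)"
  have kp: "Poly_Mapping.keys p = {m}" by (simp add: p_def)
  have "mpoly_homogeneous CARD('h) p"
    using assms by (simp add: mpoly_homogeneous_def kp keys lookup card_image)
  moreover have "mpoly_eval p f = (\<Prod>j\<in>UNIV. f (x j))" for f
    using assms by (simp add: mpoly_eval_def kp keys lookup prod.reindex) (simp add: p_def)
  ultimately show ?thesis by (intro exI[of _ p]) (simp add: mpoly_vars_def kp keys)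
qed

text \<open>Different \<open>c\<close> may yield the same monomial; adding polynomials one at a time
  accumulates its coefficient.\<close>

lemma sum_of_squarefree_monomials_mpoly:
  fixes x :: "'c \<Rightarrow> 'h::finite \<Rightarrow> 'v"
  assumes "finite C" "\<And>c. c \<in> C \<Longrightarrow> inj (x c)" "\<And>c j. c \<in> C \<Longrightarrow> x c j \<in> V"
  shows "\<exists>p. mpoly_homogeneous CARD('h) p \<and> mpoly_vars p \<subseteq> V \<and>
             (\<forall>f. mpoly_eval p f = (\<Sum>c\<in>C. \<Prod>j\<in>UNIV. f (x c j)))"
  using assms
proof (induction C rule: finite_induct)
  case empty
  show ?case
    by (intro exI[of _ 0]) (simp add: mpoly_homogeneous_def mpoly_vars_def mpoly_eval_def)
next
  case (insert c C)
  obtain p where p: "mpoly_homogeneous CARD('h) p" "mpoly_vars p \<subseteq> V"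
    "\<And>f. mpoly_eval p f = (\<Sum>c\<in>C. \<Prod>j\<in>UNIV. f (x c j))"
    using insert by auto
  obtain q where q: "mpoly_homogeneous CARD('h) q" "mpoly_vars q = range (x c)"
    "\<And>f. mpoly_eval q f = (\<Prod>j\<in>UNIV. f (x c j))"
    using squarefree_monomial_mpoly[of "x c"] insert.prems(1)[of c] by auto
  have "mpoly_vars q \<subseteq> V" using q(2) insert.prems(2)[of c] by auto
  hence "mpoly_vars (q + p) \<subseteq> V" using p(2) mpoly_vars_add[of q p] by blast
  thus ?case
    using mpoly_homogeneous_add[OF q(1) p(1)] insert.hyps p(3) q(3)
    by (intro exI[of _ "q + p"]) (simp add: mpoly_eval_add)
qed

section \<open>Decomposition into cosets\<close>

lemma conj_transpose_mult: "conj_transpose (A ** B) = conj_transpose B ** conj_transpose A"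
  by (simp add: conj_transpose_def matrix_matrix_mult_def vec_eq_iff mult.commute)

lemma conj_transpose_complex_mat: "conj_transpose (complex_mat S) = complex_mat (transpose S)"
  by (simp add: conj_transpose_def complex_mat_def transpose_def vec_eq_iff)

lemma complex_mat_mult: "complex_mat (A ** B) = complex_mat A ** complex_mat B"
  by (simp add: complex_mat_def matrix_matrix_mult_def vec_eq_iff)

lemma complex_mat_mat_1: "complex_mat (mat 1) = mat 1"
  by (simp add: complex_mat_def mat_def vec_eq_iff)

lemma matrix_add_rdistrib:
  fixes A B :: "complex ^ 'n ^ 'm"
  shows "(A + B) ** C = A ** C + B ** C"
  by (simp add: matrix_matrix_mult_def vec_eq_iff distrib_right sum.distrib)

lemma matrix_diff_rdistrib:
  fixes A B :: "complex ^ 'n ^ 'm"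
  shows "(A - B) ** C = A ** C - B ** C"
  by (simp add: matrix_matrix_mult_def vec_eq_iff left_diff_distrib sum_subtractf)

lemma column_add: "column j (A + B) = column j A + column j B"
  by (simp add: column_def vec_eq_iff)

lemma conj_transpose_mult_nth:
  "(conj_transpose X ** Y) $ i $ j = sesq (column i X) (column j Y)"
  by (simp add: conj_transpose_def matrix_matrix_mult_def sesq_def column_def)

lemma column_matrix_mult: "column j (A ** B) = A *v column j B"
  by (simp add: column_def matrix_matrix_mult_def matrix_vector_mult_def vec_eq_iff)

text \<open>Cyclicity of the trace brings the two factors coming from \<open>S\<close> around
  \<open>P\<close>. The resulting diagonal matrix keeps only diagonal entries, one for each column
  of \<open>Y\<close>.\<close>

lemma trace_quadratic_diagonalized:
  fixes Y :: "complex ^ 'h ^ 'g" and S P :: "real ^ 'h ^ 'h"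
  assumes "S ** P ** transpose S = (\<chi> i j. if i = j then l i else 0)"
  shows "trace (conj_transpose (Y ** complex_mat S) ** W ** (Y ** complex_mat S) ** complex_mat P)
         = (\<Sum>j\<in>UNIV. sesq (column j Y) ((l j *\<^sub>R W) *v column j Y))"
proof -
  let ?S = "complex_mat S" and ?P = "complex_mat P"
  let ?M = "conj_transpose Y ** (W ** Y)"
  have "trace (conj_transpose (Y ** ?S) ** W ** (Y ** ?S) ** ?P)
        = trace (complex_mat (transpose S) ** (?M ** ?S ** ?P))"
    by (simp only: conj_transpose_mult conj_transpose_complex_mat matrix_mul_assoc)
  also have "\<dots> = trace (?M ** ?S ** ?P ** complex_mat (transpose S))"
    by (rule trace_mul_sym)
  also have "?M ** ?S ** ?P ** complex_mat (transpose S) = ?M ** complex_mat (S ** P ** transpose S)"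
    by (simp only: complex_mat_mult matrix_mul_assoc)
  also have "trace \<dots> = (\<Sum>j\<in>UNIV. ?M $ j $ j * of_real (l j))"
    unfolding assms trace_def
    by (simp add: matrix_matrix_mult_def[of ?M] complex_mat_def if_distrib cong: if_cong)
  also have "\<dots> = (\<Sum>j\<in>UNIV. sesq (column j Y) ((l j *\<^sub>R W) *v column j Y))"
    by (simp add: conj_transpose_mult_nth column_matrix_mult sesq_scaleR_matrix mult.commute)
  finally show ?thesis .
qed

text \<open>The same cyclic shift moves \<open>S\<close> from the argument to the characteristic
  \<open>B\<close>.\<close>

lemma trace_linear_transformed:
  fixes Y B :: "complex ^ 'h ^ 'g" and S :: "real ^ 'h ^ 'h"
  shows "trace (conj_transpose (Y ** complex_mat S) ** B)
         = (\<Sum>j\<in>UNIV. sesq (column j Y) (column j (B ** complex_mat (transpose S))))"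
proof -
  have "trace (conj_transpose (Y ** complex_mat S) ** B)
        = trace (complex_mat (transpose S) ** (conj_transpose Y ** B))"
    by (simp only: conj_transpose_mult conj_transpose_complex_mat matrix_mul_assoc)
  also have "\<dots> = trace (conj_transpose Y ** B ** complex_mat (transpose S))"
    by (rule trace_mul_sym)
  also have "\<dots> = trace (conj_transpose Y ** (B ** complex_mat (transpose S)))"
    by (simp only: matrix_mul_assoc)
  finally show ?thesis by (simp add: trace_def conj_transpose_mult_nth)
qed

text \<open>Stated for general \<open>R\<close> and \<open>C\<close> to serve both algebraic
  integers with integral matrices and field elements with rational ones.\<close>

lemma mat_over_mult:
  assumes "0 \<in> R" "\<And>x y. x \<in> R \<Longrightarrow> y \<in> R \<Longrightarrow> x + y \<in> R"
    and "\<And>x c. x \<in> R \<Longrightarrow> c \<in> C \<Longrightarrow> x * complex_of_real c \<in> R"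
    and "N \<in> mat_over R" "S \<in> mat_over C"
  shows "N ** complex_mat S \<in> mat_over R"
proof -
  have sum: "sum f A \<in> R" if "finite A" "\<And>x. x \<in> A \<Longrightarrow> f x \<in> R" for f :: "'x \<Rightarrow> complex" and A
    using that by (induction A rule: finite_induct) (auto intro: assms(1,2))
  show ?thesis
    using assms(3-5) unfolding mat_over_def matrix_matrix_mult_def complex_mat_def
    by (auto intro!: sum)
qed

lemma ring_of_integers_mat_mult:
  assumes "d > 0" "N \<in> mat_over (ring_of_integers (quad_field d))" "S \<in> mat_over \<int>"
  shows "N ** complex_mat S \<in> mat_over (ring_of_integers (quad_field d))"
  using assms ring_of_integers_Ints_mult[OF assms(1)] ring_of_integers_add[OF assms(1)]
  by (intro mat_over_mult[of _ "\<int>"] ring_of_integers_0) (auto simp: mult.commute)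

lemma quad_field_mat_mult:
  assumes "d > 0" "A \<in> mat_over (quad_field d)" "T \<in> mat_over \<rat>"
  shows "A ** complex_mat T \<in> mat_over (quad_field d)"
  using assms quad_field_Rats_mult[OF assms(1)] quad_field_add[OF assms(1)]
  by (intro mat_over_mult[of _ "\<rat>"]) (auto simp: mult.commute quad_field_iff)

section \<open>Cosets of a sublattice of finite index\<close>

text \<open>For \<open>T\<close> inverse to \<open>S\<close>, this is congruence modulo the lattice
  \<open>L S\<close>, expressed without an existential quantifier.\<close>

definition coset_rel :: "complex set \<Rightarrow> complex ^ 'h ^ 'h \<Rightarrow> ((complex ^ 'h ^ 'g) \<times> (complex ^ 'h ^ 'g)) set" where
  "coset_rel R T = {(M, N). M \<in> mat_over R \<and> N \<in> mat_over R \<and> (N - M) ** T \<in> mat_over R}"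

lemma equiv_coset_rel:
  fixes T :: "complex ^ 'h ^ 'h"
  assumes d: "d > 0"
  defines "R \<equiv> ring_of_integers (quad_field d)"
  shows "equiv (mat_over R :: (complex ^ 'h ^ 'g) set) (coset_rel R T)"
proof (rule equivI)
  let ?L = "mat_over R :: (complex ^ 'h ^ 'g) set"
  let ?rel = "coset_rel R T :: ((complex ^ 'h ^ 'g) \<times> (complex ^ 'h ^ 'g)) set"
  have zero: "0 \<in> ?L" using ring_of_integers_0[OF d] by (simp add: mat_over_def R_def)
  have minus: "X - Y \<in> ?L" if "X \<in> ?L" "Y \<in> ?L" for X Y
    using that ring_of_integers_minus[OF d] by (simp add: mat_over_def R_def)
  have add: "X + Y \<in> ?L" if "X \<in> ?L" "Y \<in> ?L" for X Y
    using that ring_of_integers_add[OF d] by (simp add: mat_over_def R_def)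
  show "refl_on ?L ?rel"
    using zero by (auto simp: refl_on_def coset_rel_def)
  show "sym ?rel"
  proof (rule symI)
    fix M N assume "(M, N) \<in> ?rel"
    thus "(N, M) \<in> ?rel"
      using minus[OF zero, of "(N - M) ** T"] by (auto simp: coset_rel_def matrix_diff_rdistrib)
  qed
  show "trans ?rel"
  proof (rule transI)
    fix M N X assume "(M, N) \<in> ?rel" "(N, X) \<in> ?rel"
    thus "(M, X) \<in> ?rel"
      using add[of "(N - M) ** T" "(X - N) ** T"] by (auto simp: coset_rel_def matrix_diff_rdistrib)
  qed
qed (auto simp: coset_rel_def)

text \<open>If \<open>k T\<close> is integral and the entries of \<open>M\<close> and
  \<open>N\<close> agree modulo \<open>k\<close>, then \<open>N - M = k Q\<close> with
  \<open>Q\<close> integral, and \<open>(N - M) T = Q (k T)\<close> is integral. Only finitely many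
  residue patterns occur.\<close>

lemma finite_coset_quotient:
  fixes T :: "real ^ 'h ^ 'h"
  assumes d: "d > 0" and T: "T \<in> mat_over \<rat>"
  defines "R \<equiv> ring_of_integers (quad_field d)"
  shows "finite ((mat_over R :: (complex ^ 'h ^ 'g) set) // coset_rel R (complex_mat T))"
proof -
  let ?L = "mat_over R :: (complex ^ 'h ^ 'g) set"
  let ?rel = "coset_rel R (complex_mat T) :: ((complex ^ 'h ^ 'g) \<times> (complex ^ 'h ^ 'g)) set"
  obtain k :: int where k: "k > 0" "of_int k *\<^sub>R T \<in> mat_over \<int>"
    using common_denominator_matrix[OF T] by blast
  obtain f :: "complex \<Rightarrow> int \<times> int" where f: "finite (range f)"
    "\<And>z w. z \<in> R \<Longrightarrow> w \<in> R \<Longrightarrow> f z = f w \<Longrightarrow> (z - w) / of_int k \<in> R"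
    using finite_quotient_ring_of_integers[OF d k(1)] unfolding R_def by blast
  define F :: "complex ^ 'h ^ 'g \<Rightarrow> 'g \<Rightarrow> 'h \<Rightarrow> int \<times> int" where "F N = (\<lambda>i j. f (N $ i $ j))" for N
  have "F ` ?L \<subseteq> PiE UNIV (\<lambda>_. PiE UNIV (\<lambda>_. range f))" by (auto simp: F_def)
  hence fin: "finite (F ` ?L)"
    by (rule finite_subset) (use f(1) in \<open>auto intro!: finite_PiE\<close>)
  have rel: "(M, N) \<in> ?rel" if MN: "M \<in> ?L" "N \<in> ?L" "F M = F N" for M N
  proof -
    define Q :: "complex ^ 'h ^ 'g" where "Q = (\<chi> i j. (N $ i $ j - M $ i $ j) / of_int k)"
    have "Q \<in> ?L" using MN f(2) by (auto simp: Q_def mat_over_def F_def fun_eq_iff)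
    hence "Q ** complex_mat (of_int k *\<^sub>R T) \<in> ?L"
      unfolding R_def by (intro ring_of_integers_mat_mult d k)
    also have "Q ** complex_mat (of_int k *\<^sub>R T) = (N - M) ** complex_mat T"
      using k(1) by (simp add: Q_def complex_mat_def matrix_matrix_mult_def vec_eq_iff)
    finally show ?thesis using MN by (simp add: coset_rel_def)
  qed
  have eq: "equiv ?L ?rel" unfolding R_def by (rule equiv_coset_rel[OF d])
  \<comment> \<open>Each class is recovered from the pattern of any of its members, since the chosen
    matrix with that pattern is congruent to it.\<close>
  have "?L // ?rel \<subseteq> (\<lambda>y. ?rel `` {inv_into ?L F y}) ` F ` ?L"
  proof
    fix c assume "c \<in> ?L // ?rel"
    then obtain N where N: "N \<in> ?L" "c = ?rel `` {N}" by (auto elim: quotientE)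
    have "(inv_into ?L F (F N), N) \<in> ?rel"
      using N(1) by (intro rel inv_into_into f_inv_into_f) auto
    hence "c = ?rel `` {inv_into ?L F (F N)}" using N(2) equiv_class_eq[OF eq] by blast
    thus "c \<in> (\<lambda>y. ?rel `` {inv_into ?L F y}) ` F ` ?L" using N(1) by blast
  qed
  thus ?thesis using fin by (meson finite_imageI finite_subset)
qed

text \<open>Substituting \<open>r + N S\<close> for the summation variable turns the coset into the
  full lattice and shifts the characteristic to \<open>(r + A) T\<close>. The exponent is then a sum
  over columns, so the series is a product of vector theta series.\<close>

lemma Theta_mat_has_sum_coset:
  fixes S T P :: "real ^ 'h ^ 'h" and r A B :: "complex ^ 'h ^ 'g" and l :: "'h \<Rightarrow> real"
  assumes d: "d > 0" and S: "S \<in> mat_over \<int>" and ST: "S ** T = mat 1" and TS: "T ** S = mat 1"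
    and diag: "S ** P ** transpose S = (\<chi> i j. if i = j then l i else 0)"
    and l: "\<And>j. l j > 0" and W: "W \<in> hermitian_upper_half_space"
  defines "R \<equiv> ring_of_integers (quad_field d)"
  assumes r: "r \<in> mat_over R"
  shows "((\<lambda>N. exp (complex_of_real pi * \<i> * trace (conj_transpose (N + A) ** W ** (N + A) ** complex_mat P)
             + 2 * complex_of_real pi * \<i> * complex_of_real (Re (trace (conj_transpose (N + A) ** B)))))
          has_sum (\<Prod>j\<in>UNIV. Theta_vec (quad_field d) (column j ((r + A) ** complex_mat T))
                     (column j (B ** complex_mat (transpose S))) (l j *\<^sub>R W)))
         (coset_rel R (complex_mat T) `` {r})"
proof -
  let ?S = "complex_mat S" and ?T = "complex_mat T"
  let ?a = "\<lambda>j. column j ((r + A) ** ?T)" and ?b = "\<lambda>j. column j (B ** complex_mat (transpose S))"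
  define t where "t j n = exp (complex_of_real pi * \<i> * sesq (n + ?a j) ((l j *\<^sub>R W) *v (n + ?a j))
             + 2 * complex_of_real pi * \<i> * complex_of_real (Re (sesq (n + ?a j) (?b j))))" for j n
  define G where "G N = exp (complex_of_real pi * \<i> * trace (conj_transpose (N + A) ** W ** (N + A) ** complex_mat P)
             + 2 * complex_of_real pi * \<i> * complex_of_real (Re (trace (conj_transpose (N + A) ** B))))" for N
  have ST': "?S ** ?T = mat 1" and TS': "?T ** ?S = mat 1"
    by (simp_all add: ST TS complex_mat_mat_1 flip: complex_mat_mult)
  have cancel: "X ** ?S ** ?T = X" "X ** ?T ** ?S = X" for X :: "complex ^ 'h ^ 'g"
    by (simp_all add: ST' TS' flip: matrix_mul_assoc)
  have add: "X + Y \<in> mat_over R" if "X \<in> mat_over R" "Y \<in> mat_over R" for X Y :: "complex ^ 'h ^ 'g"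
    using that ring_of_integers_add[OF d] by (simp add: mat_over_def R_def)
  \<comment> \<open>Integrality of \<open>S\<close> keeps \<open>r + N S\<close> in the lattice; the
    definition of the coset makes the inverse map integral.\<close>
  have bij: "bij_betw (\<lambda>N. r + N ** ?S) (mat_over R) (coset_rel R ?T `` {r})"
  proof (rule bij_betwI[where g = "\<lambda>N. (N - r) ** ?T"])
    show "(\<lambda>N. r + N ** ?S) \<in> mat_over R \<rightarrow> coset_rel R ?T `` {r}"
      using r add ring_of_integers_mat_mult[OF d _ S] by (auto simp: coset_rel_def cancel R_def)
  qed (auto simp: coset_rel_def cancel)
  have G_eq: "G (r + N ** ?S) = (\<Prod>j\<in>UNIV. t j (column j N))" for N
  proof -
    define Y where "Y = N + (r + A) ** ?T"
    have Y: "r + N ** ?S + A = Y ** ?S"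
      by (simp add: Y_def matrix_add_rdistrib cancel add_ac)
    have "G (r + N ** ?S) = exp (\<Sum>j\<in>UNIV. complex_of_real pi * \<i> * sesq (column j Y) ((l j *\<^sub>R W) *v column j Y)
            + 2 * complex_of_real pi * \<i> * complex_of_real (Re (sesq (column j Y) (?b j))))"
      unfolding G_def Y trace_quadratic_diagonalized[OF diag] trace_linear_transformed
      by (simp only: Re_sum of_real_sum sum_distrib_left sum.distrib)
    also have "\<dots> = (\<Prod>j\<in>UNIV. t j (column j N))"
      by (simp add: exp_sum t_def Y_def column_add)
    finally show ?thesis .
  qed
  have "(\<lambda>n. norm (t j n)) summable_on vec_over R" for j
    unfolding t_def R_def by (rule Theta_vec_abs_summable[OF d W l])
  hence "((\<lambda>N. \<Prod>j\<in>UNIV. t j (column j N)) has_sum (\<Prod>j\<in>UNIV. infsum (t j) (vec_over R))) (mat_over R)"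
    by (rule has_sum_prod_columns)
  hence "((\<lambda>N. G (r + N ** ?S)) has_sum (\<Prod>j\<in>UNIV. infsum (t j) (vec_over R))) (mat_over R)"
    by (simp only: G_eq)
  hence "(G has_sum (\<Prod>j\<in>UNIV. infsum (t j) (vec_over R))) (coset_rel R ?T `` {r})"
    using has_sum_reindex_bij_betw[OF bij, of G] by simp
  thus ?thesis unfolding G_def t_def Theta_vec_def R_def .
qed

section \<open>Summation over the cosets\<close>

theorem theorem1p5:
  fixes K :: "complex set"
    and P :: "real ^ 'h ^ 'h"
    and A\<^sub>0 B\<^sub>0 :: "complex ^ 'h ^ 'g"
  assumes "imaginary_quadratic_field K"
    and "P \<in> mat_over \<rat>"
    and "symmetric_pos_def P"
    and "A\<^sub>0 \<in> mat_over K"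
    and "B\<^sub>0 \<in> mat_over K"
  shows "\<exists>lam :: 'h \<Rightarrow> rat. (\<forall>j. lam j > 0) \<and>
           (\<exists>p :: ('h \<times> (complex ^ 'g) \<times> (complex ^ 'g)) rat_mpoly.
              mpoly_homogeneous CARD('h) p \<and>
              mpoly_vars p \<subseteq> UNIV \<times> vec_over K \<times> vec_over K \<and>
              (\<forall>W \<in> hermitian_upper_half_space.
                 Theta_mat K (complex_mat P) A\<^sub>0 B\<^sub>0 W =
                 mpoly_eval p (\<lambda>(j, a, b). Theta_vec K a b (real_of_rat (lam j) *\<^sub>R W))))"
proof -
  obtain d where d: "d > 0" and K: "K = quad_field d"
    using assms(1) by (auto simp: imaginary_quadratic_field_def)
  obtain S T :: "real ^ 'h ^ 'h" and lam :: "'h \<Rightarrow> rat" where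
    S: "S \<in> mat_over \<int>" and T: "T \<in> mat_over \<rat>" and ST: "S ** T = mat 1" and TS: "T ** S = mat 1"
    and lam: "\<And>j. lam j > 0"
    and diag: "S ** P ** transpose S = (\<chi> i j. if i = j then of_rat (lam i) else 0)"
    using integral_diagonalization[OF assms(2,3)] by blast
  define R where "R = ring_of_integers (quad_field d)"
  define rel where "rel = (coset_rel R (complex_mat T) :: ((complex ^ 'h ^ 'g) \<times> (complex ^ 'h ^ 'g)) set)"
  define C where "C = mat_over R // rel"
  have equiv: "equiv (mat_over R) rel" unfolding rel_def R_def by (rule equiv_coset_rel[OF d])
  have fin: "finite C" unfolding C_def rel_def R_def by (rule finite_coset_quotient[OF d T])
  have "\<exists>r. r \<in> mat_over R \<and> c = rel `` {r}" if "c \<in> C" for c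
    using that unfolding C_def by (auto elim: quotientE)
  then obtain r where r: "\<And>c. c \<in> C \<Longrightarrow> r c \<in> mat_over R" "\<And>c. c \<in> C \<Longrightarrow> c = rel `` {r c}"
    by metis
  \<comment> \<open>The component \<open>j\<close> of the indeterminate selects the scaling
    \<open>lam j\<close> and makes \<open>x c\<close> injective even when characteristics
    coincide.\<close>
  define x where "x c j = (j, column j ((r c + A\<^sub>0) ** complex_mat T),
                      column j (B\<^sub>0 ** complex_mat (transpose S)))" for c j
  have S_rat: "transpose S \<in> mat_over \<rat>"
    using S Ints_subset_Rats by (auto simp: mat_over_def transpose_def)
  have column_K: "column j X \<in> vec_over K" if "X \<in> mat_over K" for X :: "complex ^ 'h ^ 'g" and j
    using that by (simp add: mat_over_def vec_over_def column_def)
  have x_mem: "x c j \<in> UNIV \<times> vec_over K \<times> vec_over K" if "c \<in> C" for c j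
  proof -
    have "r c + A\<^sub>0 \<in> mat_over K"
      using r(1)[OF that] assms(4) quad_field_add[OF d]
      by (simp add: mat_over_def K R_def ring_of_integers_def)
    hence "(r c + A\<^sub>0) ** complex_mat T \<in> mat_over K" "B\<^sub>0 ** complex_mat (transpose S) \<in> mat_over K"
      using assms(5) quad_field_mat_mult[OF d] T S_rat unfolding K by blast+
    thus ?thesis by (simp add: x_def column_K)
  qed
  have "inj (x c)" for c by (simp add: inj_def x_def)
  then obtain p where p: "mpoly_homogeneous CARD('h) p" "mpoly_vars p \<subseteq> UNIV \<times> vec_over K \<times> vec_over K"
    "\<And>f. mpoly_eval p f = (\<Sum>c\<in>C. \<Prod>j\<in>UNIV. f (x c j))"
    using sum_of_squarefree_monomials_mpoly[OF fin, of x "UNIV \<times> vec_over K \<times> vec_over K"] x_mem by blast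
  have "Theta_mat K (complex_mat P) A\<^sub>0 B\<^sub>0 W
          = mpoly_eval p (\<lambda>(j, a, b). Theta_vec K a b (real_of_rat (lam j) *\<^sub>R W))"
    if W: "W \<in> hermitian_upper_half_space" for W
  proof -
    define G where "G N = exp (complex_of_real pi * \<i> * trace (conj_transpose (N + A\<^sub>0) ** W ** (N + A\<^sub>0) ** complex_mat P)
             + 2 * complex_of_real pi * \<i> * complex_of_real (Re (trace (conj_transpose (N + A\<^sub>0) ** B\<^sub>0))))" for N
    define s where "s c = (\<Prod>j\<in>UNIV. case x c j of (j, a, b) \<Rightarrow> Theta_vec K a b (real_of_rat (lam j) *\<^sub>R W))" for c
    have "(G has_sum s c) c" if c: "c \<in> C" for c
    proof -
      have "(G has_sum s c) (rel `` {r c})"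
        unfolding G_def s_def x_def prod.case K rel_def R_def
        by (rule Theta_mat_has_sum_coset[OF d S ST TS diag _ W])
           (use lam r(1)[OF c] in \<open>auto simp: R_def\<close>)
      thus ?thesis using r(2)[OF c] by simp
    qed
    \<comment> \<open>Finitely many pairwise disjoint classes: their sums add up.\<close>
    hence "(G has_sum sum s C) (\<Union>c\<in>C. c)"
      using quotient_disj[OF equiv] unfolding C_def
      by (intro sum_has_sum fin[unfolded C_def]) blast+
    hence "(G has_sum sum s C) (mat_over R)"
      using Union_quotient[OF equiv] by (simp add: C_def)
    \<comment> \<open>Since \<open>infsum\<close> is 0 on families that are not summable, the value
      is obtained from \<open>has_sum\<close>, which includes convergence of the matrix theta
      series.\<close>
    hence "infsum G (mat_over R) = sum s C" by (rule infsumI)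
    thus ?thesis unfolding Theta_mat_def p(3) G_def s_def R_def K .
  qed
  thus ?thesis using lam p(1,2) by blast
qed

end
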